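(* Let $M_n=\max_{1\le i\le n}X_i$ denote the maximum of $n$ random variables $X_1,\dots,X_n$ (not necessarily independent), each with the same continuous distribution function $F$. Then, for each $n$, there exists an exponential random variable $E$ with $$-\log n-\log\left(1-F(M_n)\right)\le E$$ (almost surely).
   Context: An exponential variable is a random variable with the standard exponential distribution (mean $1$), i.e. $\Pr\{E>t\}=e^{-t}$ for $t\ge 0$; $E$ is defined on the same probability space as $X_1,\dots,X_n$. *)

theory Defs
  imports "HOL-Probability.Probability"
begin

(* Logarithm on [0,\<infinity>) with log 0 = -\<infinity>: the library's ln has ln 0 = 0, which would make
   -log(1 - F(M_n)) equal to 0 instead of \<infinity> where F(M_n) = 1. Negative arguments do not
   occur. *)
definition log_ereal :: "real \<Rightarrow> ereal" where
  "log_ereal x = (if x > 0 then ereal (ln x) else -\<infinity>)"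

end

(* The maximum has a continuous distribution function G, so by the probability integral transform
   E = -log (1 - G(M_n)) is standard exponential. The union bound P(M_n > t) <= n P(X_1 > t), that
   is 1 - G <= n (1 - F), evaluated at t = M_n, gives the inequality. *)
theory Submission
  imports Defs
begin

text \<open>Intermediate value theorem, between a point where the limit 0 at \<open>at_bot\<close>
  pushes the distribution function below \<open>u\<close> and one where the limit 1 at
  \<open>at_top\<close> pushes it above. The values 0 and 1 are excluded since they may be
  approached without being reached.\<close>

lemma (in real_distribution) cdf_attains:
  assumes "continuous_on UNIV (cdf M)" "0 < u" "u < 1"
  obtains t where "cdf M t = u"
proof -
  obtain a where a: "cdf M a < u"
    using order_tendstoD(2)[OF cdf_lim_at_bot \<open>0 < u\<close>] eventually_happens' trivial_limit_at_bot_linorder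
    by blast
  obtain b where b: "u < cdf M b"
    using order_tendstoD(1)[OF cdf_lim_at_top_prob \<open>u < 1\<close>] eventually_happens' trivial_limit_at_top_linorder
    by blast
  have "a \<le> b"
    using a b cdf_nondecreasing[of b a] by (cases "a \<le> b") auto
  then show thesis
    using IVT'[of "cdf M" a u b] a b continuous_on_subset[OF assms(1)] that by auto
qed

text \<open>Probability integral transform: under its own law, a continuous distribution function is
  uniformly distributed. If \<open>cdf M t\<close> has value \<open>w\<close>, then
  \<open>{..t}\<close> has measure \<open>w\<close>, so the sublevel set is compared with such
  half-lines from both sides.\<close>

lemma (in real_distribution) prob_cdf_le:
  assumes "continuous_on UNIV (cdf M)" "0 \<le> u" "u < 1"
  shows "prob {x. cdf M x \<le> u} = u"
proof (rule antisym)
  have [measurable]: "cdf M \<in> borel_measurable borel"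
    using assms(1) by (rule borel_measurable_continuous_onI)
  show "prob {x. cdf M x \<le> u} \<le> u"
  \<comment> \<open>The distribution function may stay equal to \<open>u\<close> beyond a point
    where it takes this value, so the sublevel set can stick out of that half-line. A half-line for
    a strictly larger value \<open>v\<close> does contain it; then \<open>v\<close> decreases to
    \<open>u\<close>.\<close>
  proof (rule dense_ge_bounded[OF \<open>u < 1\<close>])
    fix v assume v: "u < v" "v < 1"
    then obtain t where t: "cdf M t = v"
      using cdf_attains assms by (metis le_less_trans)
    have "x \<le> t" if "cdf M x \<le> u" for x
      using that v t cdf_nondecreasing[of t x] by (cases "x \<le> t") auto
    then have "{x. cdf M x \<le> u} \<subseteq> {..t}"
      by blast
    then show "prob {x. cdf M x \<le> u} \<le> v"
      using t finite_measure_mono[of "{x. cdf M x \<le> u}" "{..t}"] by (simp add: cdf_def)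
  qed
  show "u \<le> prob {x. cdf M x \<le> u}"
  \<comment> \<open>The value 0 need not be attained, but for \<open>u = 0\<close> the bound is just
    nonnegativity of the measure.\<close>
  proof (cases "u = 0")
    case False
    then obtain t where t: "cdf M t = u"
      using cdf_attains assms by (metis less_eq_real_def)
    have "{..t} \<subseteq> {x. cdf M x \<le> u}"
      using t cdf_nondecreasing by blast
    moreover have "{x. cdf M x \<le> u} \<in> sets M" by simp
    ultimately have "prob {..t} \<le> prob {x. cdf M x \<le> u}"
      by (rule finite_measure_mono)
    then show ?thesis using t by (simp add: cdf_def)
  qed simp
qed

text \<open>The value 1 may be reached at a finite point, but only on a null set: for each
  \<open>u\<close> in (0,1) the set where \<open>cdf M\<close> is below 1 contains the sublevel set
  at \<open>u\<close>, which has measure \<open>u\<close>.\<close>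

lemma (in real_distribution) AE_cdf_less_1:
  assumes "continuous_on UNIV (cdf M)"
  shows "AE x in M. cdf M x < 1"
proof -
  have [measurable]: "cdf M \<in> borel_measurable borel"
    using assms by (rule borel_measurable_continuous_onI)
  have "1 \<le> prob {x. cdf M x < 1}"
  proof (rule dense_le_bounded[of 0 1])
    fix u :: real assume u: "0 < u" "u < 1"
    have "prob {x. cdf M x \<le> u} \<le> prob {x. cdf M x < 1}"
      using u by (intro finite_measure_mono) auto
    then show "u \<le> prob {x. cdf M x < 1}"
      using prob_cdf_le[OF assms, of u] u by simp
  qed simp
  then have "prob {x. cdf M x < 1} = 1"
    using prob_le_1[of "{x. cdf M x < 1}"] by linarith
  then show ?thesis
    using AE_in_set_eq_1[of "{x. cdf M x < 1}"] by simp
qed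

text \<open>\<open>G (Y \<omega>)\<close> is uniform on the unit interval, and the negative
  logarithm of a uniform variable is standard exponential. The second conclusion says that almost
  surely the argument of \<open>ln\<close> is positive, so that the default value
  \<open>ln 0 = 0\<close> does no harm.\<close>

lemma (in prob_space) exponential_transform:
  fixes Y :: "'a \<Rightarrow> real"
  assumes Y[measurable]: "Y \<in> borel_measurable M"
    and G: "G = cdf (distr M borel Y)" and cont: "continuous_on UNIV G"
  shows "distributed M lborel (\<lambda>\<omega>. - ln (1 - G (Y \<omega>))) (exponential_density 1)"
    and "AE \<omega> in M. G (Y \<omega>) < 1"
proof -
  interpret D: real_distribution "distr M borel Y"
    by (rule real_distribution_distr) (rule Y)
  have [measurable]: "G \<in> borel_measurable borel"
    using cont by (rule borel_measurable_continuous_onI)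
  show less1: "AE \<omega> in M. G (Y \<omega>) < 1"
    using D.AE_cdf_less_1 cont by (simp add: G[symmetric] AE_distr_iff)
  show "distributed M lborel (\<lambda>\<omega>. - ln (1 - G (Y \<omega>))) (exponential_density 1)"
  proof (rule exponential_distributedI)
    fix a :: real assume a: "0 \<le> a"
    have "\<P>(\<omega> in M. - ln (1 - G (Y \<omega>)) \<le> a) = \<P>(\<omega> in M. G (Y \<omega>) \<le> 1 - exp (- a))"
    \<comment> \<open>The two events agree only almost everywhere: where
      \<open>G (Y \<omega>) = 1\<close>, the convention \<open>ln 0 = 0\<close> makes the left one
      true and the right one false.\<close>
    proof (rule prob_eq_AE)
      show "AE \<omega> in M. - ln (1 - G (Y \<omega>)) \<le> a \<longleftrightarrow> G (Y \<omega>) \<le> 1 - exp (- a)"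
        using less1
      proof eventually_elim
        case (elim \<omega>)
        then have "- a \<le> ln (1 - G (Y \<omega>)) \<longleftrightarrow> exp (- a) \<le> 1 - G (Y \<omega>)"
          by (intro ln_ge_iff) simp
        then show ?case by linarith
      qed
    qed measurable
    also have "\<dots> = measure (distr M borel Y) {x. G x \<le> 1 - exp (- a)}"
      by (subst measure_distr) (auto intro!: arg_cong[of _ _ prob])
    also have "\<dots> = 1 - exp (- a)"
      using D.prob_cdf_le[of "1 - exp (- a)"] cont a by (simp add: G)
    finally show "emeasure M {\<omega> \<in> space M. - ln (1 - G (Y \<omega>)) \<le> a} = 1 - ennreal (exp (- a * 1))"
      using a by (simp add: emeasure_eq_measure ennreal_minus flip: ennreal_1)
  qed auto
qed

lemma (in prob_space) cdf_distr:
  assumes [measurable]: "Y \<in> borel_measurable M"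
  shows "cdf (distr M borel Y) t = \<P>(\<omega> in M. Y \<omega> \<le> t)"
  unfolding cdf_def by (subst measure_distr) (auto intro!: arg_cong[of _ _ prob])

text \<open>The maximum exceeds \<open>t\<close> only if some \<open>X i\<close> does, and each of
  these events has probability \<open>1 - F t\<close>. Subadditivity holds under any dependence
  between the variables.\<close>

lemma (in prob_space) cdf_Max_union_bound:
  fixes X :: "'i \<Rightarrow> 'a \<Rightarrow> real" and F :: "real \<Rightarrow> real"
  assumes I: "finite I" "I \<noteq> {}"
    and X[measurable]: "\<And>i. i \<in> I \<Longrightarrow> X i \<in> borel_measurable M"
    and F: "\<And>i. i \<in> I \<Longrightarrow> cdf (distr M borel (X i)) = F"
  shows "1 - cdf (distr M borel (\<lambda>\<omega>. MAX i\<in>I. X i \<omega>)) t \<le> card I * (1 - F t)"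
proof -
  have [measurable]: "(\<lambda>\<omega>. MAX i\<in>I. X i \<omega>) \<in> borel_measurable M"
    using I by (intro borel_measurable_Max) auto
  have "1 - cdf (distr M borel (\<lambda>\<omega>. MAX i\<in>I. X i \<omega>)) t = \<P>(\<omega> in M. \<not> (MAX i\<in>I. X i \<omega>) \<le> t)"
    by (subst prob_neg) (simp_all add: cdf_distr)
  also have "\<dots> \<le> prob (\<Union>i\<in>I. {\<omega> \<in> space M. \<not> X i \<omega> \<le> t})"
    using I by (intro finite_measure_mono sets.finite_UN) auto
  also have "\<dots> \<le> (\<Sum>i\<in>I. \<P>(\<omega> in M. \<not> X i \<omega> \<le> t))"
    using I by (intro finite_measure_subadditive_finite) auto
  also have "\<dots> = (\<Sum>i\<in>I. 1 - F t)"
  proof (rule sum.cong[OF refl])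
    fix i assume i: "i \<in> I"
    note X[OF i, measurable]
    have "F t = \<P>(\<omega> in M. X i \<omega> \<le> t)"
      using cdf_distr[OF X[OF i]] F[OF i] by simp
    then show "\<P>(\<omega> in M. \<not> X i \<omega> \<le> t) = 1 - F t"
      by (subst prob_neg) simp_all
  qed
  finally show ?thesis by simp
qed

text \<open>A distribution function is continuous at \<open>t\<close> exactly when \<open>t\<close>
  is not an atom. A maximum over a finite nonempty set is attained by one of the \<open>X i\<close>,
  so the event that it equals \<open>t\<close> lies in a finite union of null events.\<close>

lemma (in prob_space) continuous_cdf_Max:
  fixes X :: "'i \<Rightarrow> 'a \<Rightarrow> real"
  assumes I: "finite I" "I \<noteq> {}"
    and X[measurable]: "\<And>i. i \<in> I \<Longrightarrow> X i \<in> borel_measurable M"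
    and cont: "\<And>i. i \<in> I \<Longrightarrow> continuous_on UNIV (cdf (distr M borel (X i)))"
  shows "continuous_on UNIV (cdf (distr M borel (\<lambda>\<omega>. MAX i\<in>I. X i \<omega>)))"
proof -
  have Mx[measurable]: "(\<lambda>\<omega>. MAX i\<in>I. X i \<omega>) \<in> borel_measurable M"
    using I by (intro borel_measurable_Max) auto
  interpret D: real_distribution "distr M borel (\<lambda>\<omega>. MAX i\<in>I. X i \<omega>)"
    by (rule real_distribution_distr) (rule Mx)
  have "isCont (cdf (distr M borel (\<lambda>\<omega>. MAX i\<in>I. X i \<omega>))) t" for t
  proof -
    have zero: "\<P>(\<omega> in M. X i \<omega> = t) = 0" if i: "i \<in> I" for i
    proof -
      interpret Xi: real_distribution "distr M borel (X i)"
        by (rule real_distribution_distr) (rule X[OF i])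
      have "measure (distr M borel (X i)) {t} = 0"
        using cont[OF i] Xi.isCont_cdf by (simp add: continuous_on_eq_continuous_at)
      then show ?thesis
        using X[OF i] by (simp add: measure_distr vimage_def Int_def conj_commute)
    qed
    have "\<P>(\<omega> in M. (MAX i\<in>I. X i \<omega>) = t) \<le> prob (\<Union>i\<in>I. {\<omega> \<in> space M. X i \<omega> = t})"
    proof (rule finite_measure_mono)
      show "{\<omega> \<in> space M. (MAX i\<in>I. X i \<omega>) = t} \<subseteq> (\<Union>i\<in>I. {\<omega> \<in> space M. X i \<omega> = t})"
      proof
        fix \<omega> assume \<omega>: "\<omega> \<in> {\<omega> \<in> space M. (MAX i\<in>I. X i \<omega>) = t}"
        have "(MAX i\<in>I. X i \<omega>) \<in> (\<lambda>i. X i \<omega>) ` I"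
          using I by (intro Max_in) auto
        then show "\<omega> \<in> (\<Union>i\<in>I. {\<omega> \<in> space M. X i \<omega> = t})"
          using \<omega> by auto
      qed
    qed (use I in auto)
    also have "\<dots> \<le> (\<Sum>i\<in>I. \<P>(\<omega> in M. X i \<omega> = t))"
      using I by (intro finite_measure_subadditive_finite) auto
    also have "\<dots> = 0"
      using zero by simp
    finally have "\<P>(\<omega> in M. (MAX i\<in>I. X i \<omega>) = t) = 0"
      by (simp add: measure_le_0_iff)
    then show ?thesis
      by (simp add: D.isCont_cdf measure_distr vimage_def Int_def conj_commute)
  qed
  then show ?thesis
    by (simp add: continuous_at_imp_continuous_on)
qed

theorem theorem2p1:
  fixes P :: "'a measure" and n :: nat and X :: "nat \<Rightarrow> 'a \<Rightarrow> real" and F :: "real \<Rightarrow> real"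
  assumes "prob_space P"
    and "n \<ge> 1"
    and "\<And>i. i \<in> {1..n} \<Longrightarrow> X i \<in> borel_measurable P"
    and "\<And>i. i \<in> {1..n} \<Longrightarrow> cdf (distr P borel (X i)) = F"
    and "continuous_on UNIV F"
  shows "\<exists>E :: 'a \<Rightarrow> real. distributed P lborel E (exponential_density 1) \<and>
    (AE \<omega> in P. - log_ereal (real n) - log_ereal (1 - F (MAX i\<in>{1..n}. X i \<omega>)) \<le> ereal (E \<omega>))"
proof -
  interpret prob_space P by fact
  define Y where "Y \<omega> = (MAX i\<in>{1..n}. X i \<omega>)" for \<omega>
  define G where "G = cdf (distr P borel Y)"
  have ne: "{1..n} \<noteq> {}"
    using \<open>n \<ge> 1\<close> by simp
  have Y: "Y \<in> borel_measurable P"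
    unfolding Y_def using assms(3) by (intro borel_measurable_Max) auto
  have cont: "continuous_on UNIV G"
    unfolding G_def Y_def using ne assms(3,4,5) by (intro continuous_cdf_Max) auto
  have bound: "1 - G t \<le> real n * (1 - F t)" for t
    using cdf_Max_union_bound[OF _ ne assms(3,4), where t = t] by (simp add: G_def Y_def[abs_def])
  have "AE \<omega> in P. - log_ereal (real n) - log_ereal (1 - F (Y \<omega>)) \<le> ereal (- ln (1 - G (Y \<omega>)))"
    using exponential_transform(2)[OF Y G_def cont]
  proof eventually_elim
    case (elim \<omega>)
    then have pos: "0 < 1 - G (Y \<omega>)" by simp
    \<comment> \<open>Positivity of \<open>1 - G\<close> passes through the union bound to
      \<open>1 - F\<close>, so both extended logarithms in the goal are finite and an inequality
      between real logarithms remains.\<close>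
    then have "0 < real n * (1 - F (Y \<omega>))"
      using bound less_le_trans by blast
    then have posF: "0 < 1 - F (Y \<omega>)"
      using \<open>n \<ge> 1\<close> by (simp add: zero_less_mult_iff)
    have "ln (1 - G (Y \<omega>)) \<le> ln (real n * (1 - F (Y \<omega>)))"
      using pos bound by (intro ln_mono) auto
    also have "\<dots> = ln (real n) + ln (1 - F (Y \<omega>))"
      using posF \<open>n \<ge> 1\<close> by (intro ln_mult_pos) auto
    finally show ?case
      using posF \<open>n \<ge> 1\<close> by (simp add: log_ereal_def)
  qed
  then show ?thesis
    using exponential_transform(1)[OF Y G_def cont] unfolding Y_def by blast
qed

end
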